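(* The $k$-Treewidth problem on $n$-vertex graphs can be solved by a deterministic one-pass streaming algorithm using $O(k\cdot n)$ space in insertion-only streams and $\widetilde{O}(k\cdot n)$ space in insertion-deletion streams.
   Context: $k$-Treewidth: given an undirected graph $G$, decide whether the treewidth of $G$ is at most $k$. Streaming model: the $n$ vertices are fixed, edges arrive one by one (insertion-only: only insertions; insertion-deletion: insertions and deletions). Space is measured in words of $O(\log n)$ bits; $\widetilde{O}$ hides $\log^{O(1)} n$ factors; unbounded computation is allowed. *)

theory Defs
  imports Complex_Main
begin

section \<open>Treewidth of finite simple graphs\<close>

text \<open>
  An undirected simple graph is a vertex set together with a set of two-element vertex sets.
  (The trees of the AFP entry Graph\_Theory are of no use here: in the symmetric digraphs of that
  entry a single undirected edge already forms a cycle.)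
\<close>

definition all_edges :: "'a set \<Rightarrow> 'a set set" where
  "all_edges V = {{u, v} | u v. u \<in> V \<and> v \<in> V \<and> u \<noteq> v}"

definition induces_connected :: "'a set set \<Rightarrow> 'a set \<Rightarrow> bool" where
  "induces_connected E X \<longleftrightarrow>
     (\<forall>u\<in>X. \<forall>v\<in>X. (u, v) \<in> {(a, b). a \<in> X \<and> b \<in> X \<and> {a, b} \<in> E}\<^sup>*)"

definition is_cycle :: "'a set set \<Rightarrow> 'a list \<Rightarrow> bool" where
  "is_cycle E xs \<longleftrightarrow> length xs \<ge> 3 \<and> distinct xs \<and>
     (\<forall>i < length xs. {xs ! i, xs ! (Suc i mod length xs)} \<in> E)"

definition is_tree :: "'a set \<Rightarrow> 'a set set \<Rightarrow> bool" where
  "is_tree V E \<longleftrightarrow> finite V \<and> V \<noteq> {} \<and> E \<subseteq> all_edges V \<and>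
     induces_connected E V \<and> (\<nexists>xs. is_cycle E xs)"

definition tree_decomposition ::
  "'v set \<Rightarrow> 'v set set \<Rightarrow> 't set \<Rightarrow> 't set set \<Rightarrow> ('t \<Rightarrow> 'v set) \<Rightarrow> bool" where
  "tree_decomposition V E T F bag \<longleftrightarrow> is_tree T F \<and>
     (\<Union>t\<in>T. bag t) = V \<and>
     (\<forall>e\<in>E. \<exists>t\<in>T. e \<subseteq> bag t) \<and>
     (\<forall>v\<in>V. induces_connected F {t \<in> T. v \<in> bag t})"

definition decomposition_width :: "'t set \<Rightarrow> ('t \<Rightarrow> 'v set) \<Rightarrow> nat" where
  "decomposition_width T bag = Max ((\<lambda>t. card (bag t)) ` T) - 1"

text \<open>
  Decomposition trees are finite, so it is no restriction to take their nodes from \<^typ>\<open>nat\<close>.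
\<close>

definition treewidth :: "'v set \<Rightarrow> 'v set set \<Rightarrow> nat" where
  "treewidth V E = (LEAST w. \<exists>(T :: nat set) F bag.
     tree_decomposition V E T F bag \<and> decomposition_width T bag = w)"


section \<open>Graph streams on the vertex set \<open>{..<n}\<close>\<close>

datatype update = Insert "nat set" | Delete "nat set"

fun apply_update :: "nat set set \<Rightarrow> update \<Rightarrow> nat set set" where
  "apply_update E (Insert e) = insert e E"
| "apply_update E (Delete e) = E - {e}"

definition graph_of_stream :: "update list \<Rightarrow> nat set set" where
  "graph_of_stream xs = foldl apply_update {} xs"

fun valid_update :: "nat \<Rightarrow> nat set set \<Rightarrow> update \<Rightarrow> bool" where
  "valid_update n E (Insert e) \<longleftrightarrow> e \<in> all_edges {..<n} \<and> e \<notin> E"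
| "valid_update n E (Delete e) \<longleftrightarrow> e \<in> E"

definition insertion_deletion_streams :: "nat \<Rightarrow> update list set" where
  "insertion_deletion_streams n =
     {xs. \<forall>i < length xs. valid_update n (graph_of_stream (take i xs)) (xs ! i)}"

definition insertion_only_streams :: "nat \<Rightarrow> update list set" where
  "insertion_only_streams n = {xs \<in> insertion_deletion_streams n. set xs \<subseteq> range Insert}"


section \<open>Deterministic one-pass streaming algorithms\<close>

text \<open>
  The memory consists of \<open>num_words\<close> words of \<open>word_bits\<close> bits each; a word is represented by the
  number it encodes. All that is retained between two stream items is the content of this memory.
  Computation is unbounded, hence the update rule and the final answer are arbitrary functions.
\<close>

record stream_alg =
  num_words :: nat
  word_bits :: nat
  init_mem :: "nat list"
  step_mem :: "nat list \<Rightarrow> update \<Rightarrow> nat list"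
  answer :: "nat list \<Rightarrow> bool"

definition memory :: "stream_alg \<Rightarrow> nat list set" where
  "memory A = {m. length m = num_words A \<and> (\<forall>w \<in> set m. w < 2 ^ word_bits A)}"

definition well_formed :: "stream_alg \<Rightarrow> bool" where
  "well_formed A \<longleftrightarrow> init_mem A \<in> memory A \<and> (\<forall>m \<in> memory A. \<forall>x. step_mem A m x \<in> memory A)"

definition run :: "stream_alg \<Rightarrow> update list \<Rightarrow> bool" where
  "run A xs = answer A (foldl (step_mem A) (init_mem A) xs)"

definition solves_treewidth :: "nat \<Rightarrow> nat \<Rightarrow> update list set \<Rightarrow> stream_alg \<Rightarrow> bool" where
  "solves_treewidth k n S A \<longleftrightarrow> well_formed A \<and>
     (\<forall>xs \<in> S. run A xs \<longleftrightarrow> treewidth {..<n} (graph_of_stream xs) \<le> k)"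

end

theory Submission
  imports Defs
begin

text \<open>
  A graph of treewidth at most \<open>k\<close> has at most \<open>k n\<close> edges, by removing leaves of the decomposition
  tree. It therefore suffices to maintain the number of edges and a linear sketch over the
  two-element field that is injective on edge sets of size at most \<open>k n\<close>: each edge is assigned a
  bit vector, and the sketch is the sum of the vectors of the present edges, so that insertions and
  deletions act alike. As in the Gilbert-Varshamov bound, suitable vectors with \<open>O(k n log n)\<close> bits
  are chosen greedily, each avoiding the sums of two small sets of earlier vectors.
  As computation is unbounded, the final answer decodes the sketch by exhaustive search. The same
  algorithm serves both stream models.
\<close>

section \<open>Graphs of bounded treewidth are sparse\<close>

lemma in_all_edges_iff: "e \<in> all_edges V \<longleftrightarrow> e \<subseteq> V \<and> card e = 2"
  by (auto simp: all_edges_def card_2_iff)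

lemma finite_all_edges: "finite V \<Longrightarrow> finite (all_edges V)"
  by (rule finite_subset[of _ "Pow V"]) (auto simp: all_edges_def)

lemma is_cycle_mono: "is_cycle F xs \<Longrightarrow> F \<subseteq> F' \<Longrightarrow> is_cycle F' xs"
  by (auto simp: is_cycle_def)

text \<open>An end vertex of a longest path is a leaf.\<close>

lemma acyclic_has_leaf:
  assumes fin: "finite T" and ne: "T \<noteq> {}" and F: "F \<subseteq> all_edges T"
    and acyc: "\<nexists>xs. is_cycle F xs"
  obtains l p where "l \<in> T" "\<And>a. {l, a} \<in> F \<Longrightarrow> a = p"
proof -
  define P where "P = {xs. xs \<noteq> [] \<and> distinct xs \<and> set xs \<subseteq> T \<and>
     (\<forall>i. Suc i < length xs \<longrightarrow> {xs ! i, xs ! Suc i} \<in> F)}"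
  obtain t where t: "t \<in> T" using ne by blast
  have "[t] \<in> P" using t by (auto simp: P_def)
  moreover have bound: "length xs < Suc (card T)" if "xs \<in> P" for xs
    using that card_mono[OF fin, of "set xs"] by (auto simp: P_def distinct_card less_Suc_eq_le)
  ultimately obtain xs where xs: "xs \<in> P" and longest: "\<And>ys. ys \<in> P \<Longrightarrow> length ys \<le> length xs"
    using ex_has_greatest_nat[of "\<lambda>xs. xs \<in> P" "[t]" length "Suc (card T)"] by (meson less_imp_le)
  then obtain x zs where xs_eq: "xs = x # zs" by (cases xs) (auto simp: P_def)
  \<comment> \<open>If \<open>zs\<close> is empty, \<open>hd zs\<close> is an unspecified value. The
    claim survives: a neighbour other than it would prolong the path.\<close>
  have "a = hd zs" if a: "{x, a} \<in> F" for a
  proof (rule ccontr)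
    assume neq: "a \<noteq> hd zs"
    have aT: "a \<in> T" "a \<noteq> x" using a F by (auto simp: all_edges_def doubleton_eq_iff)
    have "a \<in> set zs"
    proof (rule ccontr)
      assume "a \<notin> set zs"
      then have "a # xs \<in> P" using xs aT a
        by (auto simp: P_def xs_eq nth_Cons insert_commute split: nat.splits)
      then show False using longest by fastforce
    qed
    then obtain j where j: "j < length zs" "zs ! j = a" by (auto simp: in_set_conv_nth)
    with neq have j0: "j \<noteq> 0" by (metis hd_conv_nth length_greater_0_conv not_less_zero)
    \<comment> \<open>The initial segment \<open>x, zs ! 0, ..., zs ! j = a\<close> of the path is
      closed to a cycle by the edge \<open>{x, a}\<close>. It has \<open>j + 2\<close> vertices,
      hence at least three because \<open>j\<close> is not 0.\<close>
    define ys where "ys = take (Suc (Suc j)) xs"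
    have len: "length ys = Suc (Suc j)" using j by (simp add: ys_def xs_eq)
    have "is_cycle F ys" unfolding is_cycle_def
    proof (intro conjI allI impI)
      show "3 \<le> length ys" using len j0 by simp
      show "distinct ys" using xs by (simp add: ys_def P_def)
    next
      fix i assume i: "i < length ys"
      show "{ys ! i, ys ! (Suc i mod length ys)} \<in> F"
      proof (cases "i = Suc j")
        case True
        then show ?thesis using len a j by (simp add: ys_def xs_eq insert_commute)
      next
        case False
        then have "i < Suc j" "Suc i < length xs" using i len j by (auto simp: xs_eq)
        then show ?thesis using xs len by (simp add: ys_def P_def)
      qed
    qed
    then show False using acyc by blast
  qed
  moreover have "x \<in> T" using xs by (auto simp: P_def xs_eq)
  ultimately show thesis using that by blast
qed

text \<open>Contracting \<open>l\<close> onto its only possible neighbour \<open>p\<close> turns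
  every walk inside \<open>X\<close> that starts away from \<open>l\<close> into a walk avoiding
  \<open>l\<close>: a step into or out of \<open>l\<close> becomes stationary, all other steps are
  unchanged.\<close>

lemma induces_connected_remove_leaf:
  assumes conn: "induces_connected F X" and leaf: "\<And>a. {l, a} \<in> F \<Longrightarrow> a = p"
    and loop: "{l} \<notin> F"
  shows "induces_connected {e \<in> F. l \<notin> e} (X - {l})"
proof -
  let ?R = "{(a, b). a \<in> X \<and> b \<in> X \<and> {a, b} \<in> F}"
  let ?R' = "{(a, b). a \<in> X - {l} \<and> b \<in> X - {l} \<and> {a, b} \<in> {e \<in> F. l \<notin> e}}"
  define f where "f = (\<lambda>x. if x = l then p else x)"
  have contract: "(u, f b) \<in> ?R'\<^sup>*" if "(u, b) \<in> ?R\<^sup>*" "u \<noteq> l" for u b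
    using that
  proof (induction rule: rtrancl_induct)
    case base
    then show ?case by (simp add: f_def)
  next
    case (step b c)
    then have IH: "(u, f b) \<in> ?R'\<^sup>*" and bc: "b \<in> X" "c \<in> X" "{b, c} \<in> F" by auto
    show ?case
    proof (cases "b = l \<or> c = l")
      case True
      then have "f b = f c"
        using bc leaf[of b] leaf[of c] loop by (auto simp: f_def insert_commute)
      then show ?thesis using IH by simp
    next
      case False
      then have "(f b, f c) \<in> ?R'" using bc by (auto simp: f_def)
      then show ?thesis by (rule rtrancl_into_rtrancl[OF IH])
    qed
  qed
  show ?thesis unfolding induces_connected_def
  proof (intro ballI)
    fix u v assume u: "u \<in> X - {l}" and v: "v \<in> X - {l}"
    then have "(u, v) \<in> ?R\<^sup>*" using conn by (auto simp: induces_connected_def)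
    then show "(u, v) \<in> ?R'\<^sup>*" using contract[of u v] u v by (auto simp: f_def)
  qed
qed

text \<open>Charge each edge to one of its ends in \<open>W\<close>; inside \<open>B\<close> every
  vertex has at most \<open>card B - 1\<close> neighbours. With \<open>B\<close> the bag of a leaf,
  this bounds the edges lost when the leaf is removed.\<close>

lemma card_edges_meeting_le:
  assumes fin: "finite B" and W: "W \<subseteq> B" and card: "card B \<le> Suc k"
  shows "card {e \<in> all_edges B. e \<inter> W \<noteq> {}} \<le> k * card W"
proof -
  have finW: "finite W" using W fin finite_subset by blast
  have "{e \<in> all_edges B. e \<inter> W \<noteq> {}} \<subseteq> (\<Union>w\<in>W. (\<lambda>v. {w, v}) ` (B - {w}))"
    by (fastforce simp: all_edges_def)
  then have "card {e \<in> all_edges B. e \<inter> W \<noteq> {}} \<le> card (\<Union>w\<in>W. (\<lambda>v. {w, v}) ` (B - {w}))"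
    using fin finW by (intro card_mono) auto
  also have "\<dots> \<le> (\<Sum>w\<in>W. card ((\<lambda>v. {w, v}) ` (B - {w})))"
    by (rule card_UN_le[OF finW])
  also have "\<dots> \<le> (\<Sum>w\<in>W. k)"
  proof (rule sum_mono)
    fix w assume "w \<in> W"
    then have "card (B - {w}) \<le> k" using card W fin by (simp add: card_Diff_singleton subset_iff)
    then show "card ((\<lambda>v. {w, v}) ` (B - {w})) \<le> k"
      using card_image_le[of "B - {w}" "\<lambda>v. {w, v}"] fin by simp
  qed
  finally show ?thesis by (simp add: mult.commute)
qed

text \<open>Forests are allowed, so that deleting an isolated node needs no special treatment.\<close>

lemma forest_decomposition_card_edges_le:
  assumes "finite T" "F \<subseteq> all_edges T" "\<nexists>xs. is_cycle F xs"
    and "finite V" "E \<subseteq> all_edges V"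
    and "\<forall>e\<in>E. \<exists>t\<in>T. e \<subseteq> bag t"
    and "\<forall>v\<in>V. induces_connected F {t \<in> T. v \<in> bag t}"
    and "\<forall>t\<in>T. finite (bag t) \<and> card (bag t) \<le> Suc k"
  shows "card E \<le> k * card V"
  using assms
proof (induction "card T" arbitrary: T F V E)
  case 0
  then have "E = {}" by auto
  then show ?case by simp
next
  case (Suc m)
  note finT = Suc.prems(1) and F = Suc.prems(2) and acyc = Suc.prems(3) and finV = Suc.prems(4)
    and E = Suc.prems(5) and cover = Suc.prems(6) and conn = Suc.prems(7) and bags = Suc.prems(8)
  have "T \<noteq> {}" using Suc.hyps by auto
  then obtain l p where l: "l \<in> T" and leaf: "\<And>a. {l, a} \<in> F \<Longrightarrow> a = p"
    using acyclic_has_leaf[OF finT _ F acyc] by metis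
  have loop: "{l} \<notin> F" using F by (auto simp: all_edges_def)
  \<comment> \<open>The vertices that occur in the leaf bag only are deleted together with the leaf.
    The edges in \<open>E2\<close> touch them and so can be covered by no bag except that of
    \<open>l\<close>; the induction hypothesis handles \<open>E1\<close>.\<close>
  define W where "W = {v \<in> V. v \<in> bag l \<and> (\<forall>t\<in>T - {l}. v \<notin> bag t)}"
  define E1 where "E1 = {e \<in> E. e \<inter> W = {}}"
  define E2 where "E2 = {e \<in> E. e \<inter> W \<noteq> {}}"
  have finE: "finite E" using E finV finite_all_edges finite_subset by blast
  have W_sub: "W \<subseteq> bag l" "W \<subseteq> V" by (auto simp: W_def)
  \<comment> \<open>A vertex of the leaf bag outside \<open>W\<close> also lies in some other bag.
    The nodes containing it are connected, and the first step from \<open>l\<close> among them can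
    only lead to \<open>p\<close>.\<close>
  have in_p: "p \<in> T - {l} \<and> v \<in> bag p" if v: "v \<in> V - W" "v \<in> bag l" for v
  proof -
    obtain t where t: "t \<in> T - {l}" "v \<in> bag t" using v by (auto simp: W_def)
    have "(l, t) \<in> {(a, b). a \<in> {t \<in> T. v \<in> bag t} \<and> b \<in> {t \<in> T. v \<in> bag t} \<and> {a, b} \<in> F}\<^sup>*"
      using conn v t l unfolding induces_connected_def by blast
    then obtain b where b: "b \<in> T" "v \<in> bag b" "{l, b} \<in> F"
      by (cases rule: converse_rtranclE) (use t in auto)
    then have "b = p" "b \<noteq> l" using leaf loop by auto
    then show ?thesis using b by auto
  qed
  have "card E1 \<le> k * card (V - W)"
  proof (rule Suc.hyps(1)[of "T - {l}" "{e \<in> F. l \<notin> e}"])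
    show "m = card (T - {l})" using Suc.hyps(2) l finT by simp
    show "finite (T - {l})" "finite (V - W)" using finT finV by auto
    show "{e \<in> F. l \<notin> e} \<subseteq> all_edges (T - {l})" using F by (auto simp: subset_iff in_all_edges_iff)
    show "\<nexists>xs. is_cycle {e \<in> F. l \<notin> e} xs" 
      using acyc is_cycle_mono[of "{e \<in> F. l \<notin> e}" _ F] by blast
    show "E1 \<subseteq> all_edges (V - W)" using E by (auto simp: subset_iff in_all_edges_iff E1_def)
    show "\<forall>t\<in>T - {l}. finite (bag t) \<and> card (bag t) \<le> Suc k" using bags by auto
    show "\<forall>v\<in>V - W. induces_connected {e \<in> F. l \<notin> e} {t \<in> T - {l}. v \<in> bag t}"
    proof
      fix v assume "v \<in> V - W"
      then have "induces_connected F {t \<in> T. v \<in> bag t}" using conn by blast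
      from induces_connected_remove_leaf[OF this leaf loop]
      have "induces_connected {e \<in> F. l \<notin> e} ({t \<in> T. v \<in> bag t} - {l})" .
      moreover have "{t \<in> T. v \<in> bag t} - {l} = {t \<in> T - {l}. v \<in> bag t}" by auto
      ultimately show "induces_connected {e \<in> F. l \<notin> e} {t \<in> T - {l}. v \<in> bag t}" by simp
    qed
    \<comment> \<open>An edge covered by the leaf bag and disjoint from \<open>W\<close> has both
      ends in the bag of \<open>p\<close>, which takes over covering it.\<close>
    show "\<forall>e\<in>E1. \<exists>t\<in>T - {l}. e \<subseteq> bag t"
    proof
      fix e assume e: "e \<in> E1"
      then have eV: "e \<subseteq> V - W" "e \<noteq> {}" using E by (auto simp: subset_iff E1_def in_all_edges_iff)
      obtain t where t: "t \<in> T" "e \<subseteq> bag t" using cover e by (auto simp: E1_def)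
      show "\<exists>t\<in>T - {l}. e \<subseteq> bag t"
      proof (cases "t = l")
        case True
        then have "\<And>v. v \<in> e \<Longrightarrow> p \<in> T - {l} \<and> v \<in> bag p" using in_p eV t by blast
        then show ?thesis using eV by blast
      qed (use t in auto)
    qed
  qed
  moreover have "card E2 \<le> k * card W"
  proof -
    have "E2 \<subseteq> {e \<in> all_edges (bag l). e \<inter> W \<noteq> {}}"
    proof
      fix e assume e: "e \<in> E2"
      then obtain w where w: "w \<in> e" "w \<in> W" by (auto simp: E2_def)
      obtain t where t: "t \<in> T" "e \<subseteq> bag t" using cover e by (auto simp: E2_def)
      with w have "t = l" by (auto simp: W_def)
      then show "e \<in> {e \<in> all_edges (bag l). e \<inter> W \<noteq> {}}"
        using e t E by (auto simp: subset_iff E2_def in_all_edges_iff)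
    qed
    then have "card E2 \<le> card {e \<in> all_edges (bag l). e \<inter> W \<noteq> {}}"
      using bags l by (intro card_mono) (auto simp: finite_all_edges)
    also have "\<dots> \<le> k * card W"
      using bags l W_sub by (intro card_edges_meeting_le) auto
    finally show ?thesis .
  qed
  moreover have "card E = card E1 + card E2"
  proof -
    have "E = E1 \<union> E2" "E1 \<inter> E2 = {}" by (auto simp: E1_def E2_def)
    then show ?thesis using finE card_Un_disjoint[of E1 E2] by simp
  qed
  moreover have "card V = card (V - W) + card W"
    using card_Diff_subset[of W V] W_sub(2) finV card_mono[of V W] finite_subset[of W V] by simp
  ultimately show ?case by (simp add: distrib_left)
qed

lemma treewidth_le_imp_card_edges_le:
  assumes finV: "finite V" and E: "E \<subseteq> all_edges V" and tw: "treewidth V E \<le> k"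
  shows "card E \<le> k * card V"
proof -
  let ?P = "\<lambda>w. \<exists>(T :: nat set) F bag.
     tree_decomposition V E T F bag \<and> decomposition_width T bag = w"
  \<comment> \<open>The decomposition with the single bag \<open>V\<close> makes the set under
    \<open>LEAST\<close> nonempty, so the treewidth is attained by an actual decomposition.\<close>
  have "tree_decomposition V E {0::nat} {} (\<lambda>_. V)"
    using E by (auto simp: tree_decomposition_def is_tree_def induces_connected_def is_cycle_def
        subset_iff in_all_edges_iff intro: exI[of _ 0])
  then have "\<exists>w. ?P w" by blast
  then have "?P (treewidth V E)" unfolding treewidth_def by (rule LeastI_ex)
  then obtain T F bag where td: "tree_decomposition V E (T :: nat set) F bag"
    and w: "decomposition_width T bag \<le> k" using tw by auto
  have tree: "finite T" "F \<subseteq> all_edges T" "\<nexists>xs. is_cycle F xs"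
    using td by (auto simp: tree_decomposition_def is_tree_def)
  have bags: "\<forall>t\<in>T. finite (bag t) \<and> card (bag t) \<le> Suc k"
  proof
    fix t assume t: "t \<in> T"
    then have "bag t \<subseteq> V" using td by (auto simp: tree_decomposition_def)
    moreover have "card (bag t) \<le> Max ((\<lambda>t. card (bag t)) ` T)" using t tree(1) by simp
    ultimately show "finite (bag t) \<and> card (bag t) \<le> Suc k"
      using w finV finite_subset by (auto simp: decomposition_width_def)
  qed
  show ?thesis
    by (rule forest_decomposition_card_edges_le[OF tree finV E _ _ bags])
      (use td in \<open>auto simp: tree_decomposition_def\<close>)
qed

section \<open>A parity sketch separating small sets\<close>

text \<open>Vectors over the two-element field are represented by their supports. For finite
  \<open>Y\<close> this is the support of the sum of the vectors \<open>v y\<close>, and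
  \<open>sym_diff\<close> is vector addition.\<close>

definition parity_sum :: "('a \<Rightarrow> nat set) \<Rightarrow> 'a set \<Rightarrow> nat set" where
  "parity_sum v Y = {i. odd (card {y \<in> Y. i \<in> v y})}"

lemma parity_sum_empty [simp]: "parity_sum v {} = {}"
  by (simp add: parity_sum_def)

lemma parity_sum_insert:
  assumes "finite Y" "x \<notin> Y"
  shows "parity_sum v (insert x Y) = sym_diff (v x) (parity_sum v Y)"
proof -
  have "{y \<in> insert x Y. i \<in> v y} =
      (if i \<in> v x then insert x {y \<in> Y. i \<in> v y} else {y \<in> Y. i \<in> v y})" for i
    by auto
  then show ?thesis using assms by (auto simp: parity_sum_def)
qed

lemma parity_sum_cong: "(\<And>y. y \<in> Y \<Longrightarrow> v y = v' y) \<Longrightarrow> parity_sum v Y = parity_sum v' Y"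
  unfolding parity_sum_def by (metis (mono_tags, lifting) Collect_cong)

lemma parity_sum_remove:
  assumes "finite Y" "x \<in> Y"
  shows "parity_sum v (Y - {x}) = sym_diff (v x) (parity_sum v Y)"
  using parity_sum_insert[of "Y - {x}" x v] assms by (auto simp: insert_absorb)

lemma parity_sum_subset:
  assumes "finite Y" "\<And>y. y \<in> Y \<Longrightarrow> v y \<subseteq> S"
  shows "parity_sum v Y \<subseteq> S"
proof
  fix i assume "i \<in> parity_sum v Y"
  then have "{y \<in> Y. i \<in> v y} \<noteq> {}" by (intro notI) (simp add: parity_sum_def)
  then show "i \<in> S" using assms by auto
qed

text \<open>List the elements of a small set and pad with \<open>None\<close> to length exactly
  \<open>s\<close>. Every such set is recovered from a word of length \<open>s\<close> over an
  alphabet of \<open>Suc (card X)\<close> letters.\<close>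

lemma card_small_subsets_le:
  assumes fin: "finite X"
  shows "card {Y. Y \<subseteq> X \<and> card Y \<le> s} \<le> Suc (card X) ^ s"
proof -
  let ?O = "insert None (Some ` X)"
  let ?L = "{l. set l \<subseteq> ?O \<and> length l = s}"
  have "{Y. Y \<subseteq> X \<and> card Y \<le> s} \<subseteq> (\<lambda>l. {x. Some x \<in> set l}) ` ?L"
  proof
    fix Y assume Y: "Y \<in> {Y. Y \<subseteq> X \<and> card Y \<le> s}"
    then have "finite Y" using fin by (auto intro: finite_subset)
    then obtain ys where ys: "set ys = Y" "distinct ys" using finite_distinct_list by blast
    let ?l = "map Some ys @ replicate (s - card Y) None"
    have "length ?l = s" using Y ys distinct_card[of ys] by simp
    moreover have "set ?l \<subseteq> ?O" using Y ys by auto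
    moreover have "Y = {x. Some x \<in> set ?l}" using ys by auto
    ultimately show "Y \<in> (\<lambda>l. {x. Some x \<in> set l}) ` ?L"
      by (intro image_eqI[where x = ?l]) simp_all
  qed
  moreover have finO: "finite ?O" using fin by simp
  ultimately have "card {Y. Y \<subseteq> X \<and> card Y \<le> s} \<le> card ?L"
    by (intro surj_card_le finite_lists_length_eq)
  also have "\<dots> = card ?O ^ s" by (rule card_lists_length_eq[OF finO])
  also have "card ?O = Suc (card X)" using fin by (simp add: card_image)
  finally show ?thesis .
qed

text \<open>The vectors are chosen one at a time. A new one must avoid the differences of sums of
  two small sets of earlier elements; there are at most \<open>Suc (card X) ^ (2 * s)\<close> of
  these, fewer than the \<open>2 ^ r\<close> available vectors.\<close>

lemma exists_separating_parity_sum: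
  assumes "finite X" "Suc (card X) ^ (2 * s) < 2 ^ r"
  shows "\<exists>v. (\<forall>x\<in>X. v x \<subseteq> {..<r}) \<and> inj_on (parity_sum v) {Y. Y \<subseteq> X \<and> card Y \<le> s}"
  using assms
proof (induction rule: finite_induct)
  case empty
  show ?case by (auto simp: inj_on_def)
next
  case (insert x X)
  let ?S = "{Y. Y \<subseteq> X \<and> card Y \<le> s}"
  have finS: "finite ?S" using insert.hyps by simp
  have bound: "Suc (card X) ^ (2 * s) < 2 ^ r"
    using insert.prems insert.hyps power_mono[of "Suc (card X)" "Suc (Suc (card X))" "2 * s"]
    by simp
  then obtain v where v: "\<forall>x\<in>X. v x \<subseteq> {..<r}" and inj: "inj_on (parity_sum v) ?S"
    using insert.IH by blast
  let ?D = "(\<lambda>(A, B). sym_diff (parity_sum v A) (parity_sum v B)) ` (?S \<times> ?S)"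
  have "card ?D \<le> card (?S \<times> ?S)" using finS by (intro card_image_le) auto
  also have "\<dots> \<le> Suc (card X) ^ s * Suc (card X) ^ s"
    unfolding card_cartesian_product
    by (intro mult_mono card_small_subsets_le insert.hyps) auto
  also have "\<dots> = Suc (card X) ^ (2 * s)" by (simp add: mult_2 power_add)
  also have "\<dots> < card (Pow {..<r})" using bound by (simp add: card_Pow)
  finally have "\<not> Pow {..<r} \<subseteq> ?D"
    using finS card_mono[of ?D "Pow {..<r}"] by fastforce
  then obtain z where z: "z \<subseteq> {..<r}" "z \<notin> ?D" by blast
  let ?v = "v(x := z)"
  have old: "parity_sum ?v Y = parity_sum v Y" if "Y \<subseteq> X" for Y
    using that insert.hyps by (intro parity_sum_cong) auto
  have new: "parity_sum ?v Y = sym_diff z (parity_sum v (Y - {x})) \<and> Y - {x} \<in> ?S"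
    if "Y \<subseteq> insert x X" "card Y \<le> s" "x \<in> Y" for Y
  proof -
    have "finite Y" using that insert.hyps finite_subset by blast
    moreover have "Y - {x} \<subseteq> X" using that by auto
    moreover have "card (Y - {x}) \<le> s" using that card_Diff1_le[of Y x] by linarith
    ultimately show ?thesis
      using parity_sum_insert[of "Y - {x}" x ?v] old[of "Y - {x}"] that by (simp add: insert_absorb)
  qed
  have notin: "z \<noteq> sym_diff (parity_sum v A) (parity_sum v B)" if "A \<in> ?S" "B \<in> ?S" for A B
    using z(2) that by blast
  \<comment> \<open>If a set containing \<open>x\<close> collided with one lacking it, solving for
    \<open>z\<close> would exhibit it as a forbidden difference in \<open>?D\<close>. If both sets
    contain \<open>x\<close>, the two copies of \<open>z\<close> cancel and the old injectivity
    applies.\<close>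
  have half: False if "A \<subseteq> insert x X" "card A \<le> s" "x \<in> A" "B \<in> ?S"
    "parity_sum ?v A = parity_sum v B" for A B
  proof -
    have "z = sym_diff (parity_sum v (A - {x})) (parity_sum v B)"
      using new[OF that(1-3)] that(5) by blast
    then show False using notin new[OF that(1-3)] that(4) by blast
  qed
  have "A = B" if A: "A \<subseteq> insert x X" "card A \<le> s" and B: "B \<subseteq> insert x X" "card B \<le> s"
    and eq: "parity_sum ?v A = parity_sum ?v B" for A B
  proof -
    consider "x \<in> A" "x \<in> B" | "x \<in> A" "B \<subseteq> X" | "x \<in> B" "A \<subseteq> X" | "A \<subseteq> X" "B \<subseteq> X"
      using A B by blast
    then show ?thesis
    proof cases
      case 1
      then have "parity_sum v (A - {x}) = parity_sum v (B - {x})"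
        using new[OF A] new[OF B] eq by blast
      then have "A - {x} = B - {x}" using inj new[OF A] new[OF B] 1 by (meson inj_onD)
      then show ?thesis using 1 by blast
    next
      case 2
      then show ?thesis using half[OF A, of B] B eq old[of B] by simp
    next
      case 3
      then show ?thesis using half[OF B, of A] A eq old[of A] by simp
    next
      case 4
      then show ?thesis using inj A B eq old by (auto dest: inj_onD)
    qed
  qed
  then have "inj_on (parity_sum ?v) {Y. Y \<subseteq> insert x X \<and> card Y \<le> s}"
    by (auto intro!: inj_onI)
  moreover have "\<forall>y\<in>insert x X. ?v y \<subseteq> {..<r}" using v z by simp
  ultimately show ?case by blast
qed

section \<open>Streaming algorithms from finite automata\<close>

text \<open>There are \<open>2 ^ (w * m)\<close> memory contents, so the states can be encoded
  injectively by them. This reduces the space analysis to counting states.\<close>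

lemma automaton_stream_alg:
  fixes Q :: "'q set" and \<delta> :: "'q \<Rightarrow> update \<Rightarrow> 'q"
  assumes fin: "finite Q" and card: "card Q \<le> 2 ^ (w * m)" and q0: "q0 \<in> Q"
    and \<delta>: "\<And>q x. q \<in> Q \<Longrightarrow> \<delta> q x \<in> Q"
  obtains A where "num_words A = m" "word_bits A = w" "well_formed A"
    "\<And>xs. run A xs \<longleftrightarrow> P (foldl \<delta> q0 xs)"
proof -
  let ?M = "{ws. set ws \<subseteq> {..<2 ^ w :: nat} \<and> length ws = m}"
  have "card ?M = 2 ^ (w * m)" by (simp add: card_lists_length_eq power_mult)
  then obtain f where f: "f ` Q \<subseteq> ?M" "inj_on f Q"
    using card_le_inj[OF fin, of ?M] card finite_lists_length_eq[of "{..<2 ^ w}" m] by auto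
  define g where "g = inv_into Q f"
  have gf: "g (f q) = q" if "q \<in> Q" for q using f that by (simp add: g_def)
  \<comment> \<open>\<open>well_formed\<close> quantifies over all memory contents, including those
    that encode no state; on these the step resets to the encoding of \<open>q0\<close>. A run never
    meets them.\<close>
  define A where "A = \<lparr>num_words = m, word_bits = w, init_mem = f q0,
    step_mem = (\<lambda>ws x. if ws \<in> f ` Q then f (\<delta> (g ws) x) else f q0),
    answer = (\<lambda>ws. P (g ws))\<rparr>"
  have mem: "memory A = ?M" by (auto simp: memory_def A_def)
  have "step_mem A ws x \<in> ?M" for ws x
    using f(1) q0 \<delta> gf by (cases "ws \<in> f ` Q") (auto simp: A_def image_subset_iff)
  moreover have "init_mem A \<in> ?M" using f(1) q0 by (auto simp: A_def)
  ultimately have "well_formed A" unfolding well_formed_def mem by blast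
  moreover have "foldl (step_mem A) (f q) xs = f (foldl \<delta> q xs) \<and> foldl \<delta> q xs \<in> Q"
    if "q \<in> Q" for q xs
    using that by (induction xs arbitrary: q) (auto simp: A_def gf \<delta>)
  then have "run A xs \<longleftrightarrow> P (foldl \<delta> q0 xs)" for xs
    using q0 gf by (simp add: run_def A_def)
  ultimately show thesis using that[of A] by (simp add: A_def)
qed

section \<open>Valid streams and the sketching algorithm\<close>

lemma insertion_deletion_streams_snoc:
  "xs @ [x] \<in> insertion_deletion_streams n \<longleftrightarrow>
     xs \<in> insertion_deletion_streams n \<and> valid_update n (graph_of_stream xs) x"
  by (auto simp: insertion_deletion_streams_def less_Suc_eq nth_append)

lemma graph_of_stream_snoc:
  "graph_of_stream (xs @ [x]) = apply_update (graph_of_stream xs) x"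
  by (simp add: graph_of_stream_def)

lemma graph_of_stream_subset:
  "xs \<in> insertion_deletion_streams n \<Longrightarrow> graph_of_stream xs \<subseteq> all_edges {..<n}"
proof (induction xs rule: rev_induct)
  case Nil
  then show ?case by (simp add: graph_of_stream_def)
next
  case (snoc x xs)
  then show ?case
    by (cases x) (auto simp: insertion_deletion_streams_snoc graph_of_stream_snoc)
qed

text \<open>Edges are images of ordered pairs with distinct entries. Discarding the pair
  \<open>(0, 0)\<close> makes room for the successor, which is the form that the counting bound for
  the sketch requires.\<close>

lemma card_all_edges_less:
  assumes "n \<ge> 1"
  shows "Suc (card (all_edges {..<n})) \<le> n ^ 2"
proof -
  let ?D = "{..<n} \<times> {..<n} - {(0, 0)}"
  have "all_edges {..<n} \<subseteq> (\<lambda>(u, v). {u, v}) ` ?D"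
  proof
    fix e assume "e \<in> all_edges {..<n}"
    then obtain u v where "e = {u, v}" "u < n" "v < n" "u \<noteq> v" by (auto simp: all_edges_def)
    then show "e \<in> (\<lambda>(u, v). {u, v}) ` ?D" by (intro image_eqI[where x = "(u, v)"]) auto
  qed
  then have "card (all_edges {..<n}) \<le> card ?D"
    by (rule surj_card_le[rotated]) simp
  also have "\<dots> = n ^ 2 - 1"
    using assms by (subst card_Diff_subset) (auto simp: power2_eq_square)
  finally show ?thesis using assms one_le_power[of n 2] by linarith
qed

lemma sketching_stream_alg:
  assumes n: "n \<ge> 1" and nL: "n \<le> 2 ^ L" and L: "L \<ge> 1"
  obtains A where "num_words A = 4 * (k * n) + 3" "word_bits A = L"
    "solves_treewidth k n (insertion_deletion_streams n) A"
proof -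
  define X where "X = all_edges {..<n}"
  \<comment> \<open>\<open>s\<close> is the edge bound for treewidth at most \<open>k\<close>. As
    \<open>Suc (card X)\<close> is at most \<open>2 ^ (2 * L)\<close>, its power
    \<open>2 * s\<close> is at most \<open>2 ^ (4 * s * L)\<close>; the extra bit in
    \<open>r\<close> makes the inequality strict.\<close>
  define s where "s = k * n"
  define r where "r = 4 * s * L + 1"
  have finX: "finite X" by (simp add: X_def finite_all_edges)
  have cardX: "Suc (card X) \<le> 2 ^ (2 * L)"
    using order_trans[OF card_all_edges_less[OF n] power_mono[OF nL, of 2]]
    by (simp add: X_def power_even_eq)
  have "Suc (card X) ^ (2 * s) \<le> (2 ^ (2 * L)) ^ (2 * s)"
    by (rule power_mono[OF cardX]) simp
  also have "\<dots> = 2 ^ (4 * s * L)"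
    unfolding power_mult[symmetric] by (rule arg_cong[where f = "\<lambda>i. 2 ^ i"]) simp
  also have "\<dots> < 2 ^ r" by (simp add: r_def)
  finally have "Suc (card X) ^ (2 * s) < 2 ^ r" .
  from exists_separating_parity_sum[OF finX this]
  obtain v where v: "\<And>x. x \<in> X \<Longrightarrow> v x \<subseteq> {..<r}"
    and inj: "inj_on (parity_sum v) {Y. Y \<subseteq> X \<and> card Y \<le> s}" by auto
  define Q where "Q = {..card X} \<times> Pow {..<r}"
  define upd where "upd = (\<lambda>(c, D) x. case x of
      Insert e \<Rightarrow> (Suc c, sym_diff (v e) D) | Delete e \<Rightarrow> (c - 1, sym_diff (v e) D))"
  \<comment> \<open>The reset to \<open>(0, {})\<close> keeps \<open>Q\<close> closed under
    arbitrary updates. On valid streams it is never triggered, as \<open>state\<close>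
    shows.\<close>
  define \<delta> where "\<delta> = (\<lambda>q x. if upd q x \<in> Q then upd q x else (0, {}))"
  \<comment> \<open>Decoding is reliable only for at most \<open>s\<close> edges. A larger count is
    rejected outright, which is correct because such a graph is too dense for treewidth at most
    \<open>k\<close>.\<close>
  define P where "P = (\<lambda>(c, D). \<exists>E \<subseteq> X. card E = c \<and> c \<le> s \<and> parity_sum v E = D \<and>
      treewidth {..<n} E \<le> k)"
  \<comment> \<open>The counter takes \<open>2 * L\<close> bits and the sketch
    \<open>4 * s * L + 1\<close>; as \<open>L\<close> is at least 1, the total fits into
    \<open>4 * s + 3\<close> words of \<open>L\<close> bits.\<close>
  have "card Q \<le> 2 ^ (L * (4 * (k * n) + 3))"
  proof -
    have "card Q = Suc (card X) * 2 ^ r" by (simp add: Q_def card_cartesian_product card_Pow)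
    also have "\<dots> \<le> 2 ^ (2 * L) * 2 ^ r" using cardX by (rule mult_right_mono) simp
    also have "\<dots> = 2 ^ (2 * L + r)" by (simp add: power_add)
    also have "\<dots> \<le> 2 ^ (L * (4 * (k * n) + 3))"
      using L by (intro power_increasing) (auto simp: r_def s_def algebra_simps)
    finally show ?thesis .
  qed
  moreover have "finite Q" by (simp add: Q_def)
  moreover have q0: "(0, {}) \<in> Q" by (simp add: Q_def)
  moreover from q0 have "\<delta> q x \<in> Q" for q x by (simp add: \<delta>_def)
  ultimately obtain A where A: "num_words A = 4 * (k * n) + 3" "word_bits A = L" "well_formed A"
    "\<And>xs. run A xs \<longleftrightarrow> P (foldl \<delta> (0, {}) xs)"
    using automaton_stream_alg[of Q L "4 * (k * n) + 3" "(0, {})" \<delta> P] by metis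
  have in_Q: "(card G, parity_sum v G) \<in> Q" if "G \<subseteq> X" for G
    unfolding Q_def
    using card_mono[OF finX that]
      parity_sum_subset[OF finite_subset[OF that finX] v[OF subsetD[OF that]]] by simp
  have state: "foldl \<delta> (0, {}) xs = (card (graph_of_stream xs), parity_sum v (graph_of_stream xs))"
    if "xs \<in> insertion_deletion_streams n" for xs
    using that
  proof (induction xs rule: rev_induct)
    case Nil
    then show ?case by (simp add: graph_of_stream_def)
  next
    case (snoc x xs)
    let ?G = "graph_of_stream xs" and ?G' = "graph_of_stream (xs @ [x])"
    have xs: "xs \<in> insertion_deletion_streams n" and valid: "valid_update n ?G x"
      using snoc.prems by (auto simp: insertion_deletion_streams_snoc)
    have "finite ?G"
      by (rule finite_subset[OF graph_of_stream_subset[OF xs]]) (simp add: finite_all_edges)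
    then have "upd (card ?G, parity_sum v ?G) x = (card ?G', parity_sum v ?G')"
      using valid
      by (cases x) (simp_all add: upd_def graph_of_stream_snoc parity_sum_insert parity_sum_remove)
    moreover have "(card ?G', parity_sum v ?G') \<in> Q"
      using graph_of_stream_subset[OF snoc.prems] by (intro in_Q) (simp add: X_def)
    ultimately show ?case using snoc.IH[OF xs] by (simp add: \<delta>_def)
  qed
  have "run A xs \<longleftrightarrow> treewidth {..<n} (graph_of_stream xs) \<le> k"
    if xs: "xs \<in> insertion_deletion_streams n" for xs
  proof -
    let ?G = "graph_of_stream xs"
    have G: "?G \<subseteq> X" using graph_of_stream_subset[OF xs] by (simp add: X_def)
    have "P (card ?G, parity_sum v ?G) \<longleftrightarrow> treewidth {..<n} ?G \<le> k"
    proof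
      assume "P (card ?G, parity_sum v ?G)"
      then obtain E where E: "E \<subseteq> X" "card E = card ?G" "card ?G \<le> s"
        "parity_sum v E = parity_sum v ?G" "treewidth {..<n} E \<le> k" by (auto simp: P_def)
      \<comment> \<open>The stored count ensures that both sets have at most \<open>s\<close> edges,
        where the sketch is injective.\<close>
      then have "E = ?G" using G by (intro inj_onD[OF inj]) auto
      then show "treewidth {..<n} ?G \<le> k" using E by simp
    next
      assume tw: "treewidth {..<n} ?G \<le> k"
      then have "card ?G \<le> s"
        using treewidth_le_imp_card_edges_le[of "{..<n}" ?G k] G by (simp add: X_def s_def)
      then show "P (card ?G, parity_sum v ?G)" using G tw by (auto simp: P_def)
    qed
    then show ?thesis using A(4) state[OF xs] by simp
  qed
  then show thesis using that A by (simp add: solves_treewidth_def)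
qed

text \<open>For one vertex the logarithmic word size is 0, so no bit may be stored. The graph is
  always empty and the answer is a constant.\<close>

lemma single_vertex_stream_alg:
  obtains A where "num_words A = 0" "word_bits A = 0"
    "solves_treewidth k 1 (insertion_deletion_streams 1) A"
proof -
  obtain A where A: "num_words A = 0" "word_bits A = 0" "well_formed A"
    "\<And>xs. run A xs \<longleftrightarrow> treewidth {..<1::nat} {} \<le> k"
    using automaton_stream_alg[of "{()}" 0 0 "()" "\<lambda>_ _. ()" "\<lambda>_. treewidth {..<1::nat} {} \<le> k"]
    by auto
  have "all_edges {..<1::nat} = {}" by (auto simp: all_edges_def)
  then have "graph_of_stream xs = {}" if "xs \<in> insertion_deletion_streams 1" for xs
    using graph_of_stream_subset[OF that] by simp
  then show thesis using that A by (simp add: solves_treewidth_def)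
qed

lemma exists_treewidth_stream_alg:
  assumes k: "k \<ge> 1" and n: "n \<ge> 1"
  shows "\<exists>A. solves_treewidth k n (insertion_deletion_streams n) A \<and>
    real (word_bits A) \<le> 2 * log 2 (real n) \<and> real (num_words A) \<le> 7 * (real k * real n)"
proof (cases "n = 1")
  case True
  obtain A where "num_words A = 0" "word_bits A = 0"
    "solves_treewidth k 1 (insertion_deletion_streams 1) A"
    by (rule single_vertex_stream_alg)
  then show ?thesis using True by (intro exI[of _ A]) simp
next
  case False
  then have log1: "log 2 (real n) \<ge> 1" using n by simp
  \<comment> \<open>For \<open>n\<close> at least 2 the logarithm is at least 1, so rounding it up
    at most doubles it. This is the source of the factor 2 in the word size.\<close>
  define L where "L = nat \<lceil>log 2 (real n)\<rceil>"
  have L: "log 2 (real n) \<le> real L" "real L < log 2 (real n) + 1"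
    using log1 unfolding L_def by linarith+
  then have "L \<ge> 1" using log1 by linarith
  moreover have "real n \<le> 2 ^ L"
    using L(1) n by (simp add: log_le_iff powr_realpow)
  then have "n \<le> 2 ^ L" by (metis of_nat_le_iff of_nat_numeral of_nat_power)
  ultimately obtain A where A: "num_words A = 4 * (k * n) + 3" "word_bits A = L"
    "solves_treewidth k n (insertion_deletion_streams n) A"
    using sketching_stream_alg[OF n] by blast
  \<comment> \<open>Since \<open>k * n\<close> is at least 1, the additive 3 is absorbed into the
    constant 7.\<close>
  have "num_words A \<le> 7 * (k * n)" using A(1) k n by simp
  then have "real (num_words A) \<le> 7 * (real k * real n)"
    by (metis of_nat_le_iff of_nat_mult of_nat_numeral)
  moreover have "real (word_bits A) \<le> 2 * log 2 (real n)" using A(2) L(2) log1 by simp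
  ultimately show ?thesis using A(3) by blast
qed

theorem theorem24:
  shows "(\<exists>(A :: nat \<Rightarrow> nat \<Rightarrow> stream_alg) (c :: real) (C :: real).
            \<forall>k \<ge> 1. \<forall>n \<ge> 1.
              solves_treewidth k n (insertion_only_streams n) (A k n) \<and>
              real (word_bits (A k n)) \<le> c * log 2 (real n) \<and>
              real (num_words (A k n)) \<le> C * (real k * real n))
       \<and> (\<exists>(A :: nat \<Rightarrow> nat \<Rightarrow> stream_alg) (c :: real) (C :: real) (d :: nat).
            \<forall>k \<ge> 1. \<forall>n \<ge> 1.
              solves_treewidth k n (insertion_deletion_streams n) (A k n) \<and>
              real (word_bits (A k n)) \<le> c * log 2 (real n) \<and>
              real (num_words (A k n)) \<le> C * (real k * real n) * log 2 (real n) ^ d)"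
proof -
  obtain A where A: "\<forall>k \<ge> 1. \<forall>n \<ge> 1.
      solves_treewidth k n (insertion_deletion_streams n) (A k n) \<and>
      real (word_bits (A k n)) \<le> 2 * log 2 (real n) \<and>
      real (num_words (A k n)) \<le> 7 * (real k * real n)"
    using exists_treewidth_stream_alg by metis
  have restrict: "solves_treewidth k n (insertion_only_streams n) B"
    if "solves_treewidth k n (insertion_deletion_streams n) B" for k n B
    using that by (auto simp: solves_treewidth_def insertion_only_streams_def)
  show ?thesis
  proof
    show "\<exists>(A :: nat \<Rightarrow> nat \<Rightarrow> stream_alg) (c :: real) (C :: real). \<forall>k \<ge> 1. \<forall>n \<ge> 1.
        solves_treewidth k n (insertion_only_streams n) (A k n) \<and>
        real (word_bits (A k n)) \<le> c * log 2 (real n) \<and>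
        real (num_words (A k n)) \<le> C * (real k * real n)"
      using A restrict by blast
    show "\<exists>(A :: nat \<Rightarrow> nat \<Rightarrow> stream_alg) (c :: real) (C :: real) (d :: nat). \<forall>k \<ge> 1. \<forall>n \<ge> 1.
        solves_treewidth k n (insertion_deletion_streams n) (A k n) \<and>
        real (word_bits (A k n)) \<le> c * log 2 (real n) \<and>
        real (num_words (A k n)) \<le> C * (real k * real n) * log 2 (real n) ^ d"
      \<comment> \<open>With exponent 0 the logarithmic factor is 1, even for \<open>n = 1\<close>
        where the logarithm vanishes.\<close>
      using A by (intro exI[of _ A] exI[of _ 2] exI[of _ 7] exI[of _ 0]) simp
  qed
qed

end
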